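(* Let $s\geq 1$ and $k\geq 1$ be integers, and let $n_1,n_2$ be positive integers with $n_1\geq sk+1$ and $n_2\geq sk$. Let $\mathcal{A}_{(1,1)}^{s,k}(n_1,n_2)$ be the set of $s$-separated $k$-element subsets of $[n_1,n_2]$ that contain the element $(1,1)$. Then \[ \left|\mathcal{A}_{(1,1)}^{s,k}(n_1,n_2)\right| = \binom{n_1+n_2-sk-1}{k-1}. \]
   Context: For positive integers $n_1,\dots,n_p$, let $[n]=\{1,\dots,n\}$ and $[n_1,\dots,n_p]=([n_1]\times\{1\})\cup\cdots\cup([n_p]\times\{p\})$; the elements with second coordinate $i$ are regarded as arranged in cyclic order $1,2,\dots,n_i$ around the $i$-th circle (so $n_i$ is followed by $1$). A subset of $[n_1,\dots,n_p]$ is $s$-separated if no two of its elements lie in the same circle with fewer than $s$ elements of that circle between them; i.e. for any two distinct elements $(a,i),(b,i)$ of the set in the same circle of size $n_i$, both $|a-b|-1\geq s$ and $n_i-|a-b|-1\geq s$. Elements in different circles impose no restriction. *)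

theory Defs
  imports Complex_Main
begin

text \<open>The circles are numbered from 1, whereas list positions are numbered from 0: the
  \<open>i\<close>-th circle has size \<open>ns ! (i - 1)\<close>.\<close>

definition circles :: "nat list \<Rightarrow> (nat \<times> nat) set" where
  "circles ns = (\<Union>i\<in>{1..length ns}. {1..ns ! (i - 1)} \<times> {i})"

text \<open>The conditions are stated over the integers, so that no subtraction is truncated.\<close>

definition separated :: "nat \<Rightarrow> nat list \<Rightarrow> (nat \<times> nat) set \<Rightarrow> bool" where
  "separated s ns A \<longleftrightarrow>
     (\<forall>a b i. (a, i) \<in> A \<and> (b, i) \<in> A \<and> a \<noteq> b \<longrightarrow>
        \<bar>int a - int b\<bar> - 1 \<ge> int s \<and>
        int (ns ! (i - 1)) - \<bar>int a - int b\<bar> - 1 \<ge> int s)"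

definition separated_sets_containing ::
    "nat \<times> nat \<Rightarrow> nat \<Rightarrow> nat \<Rightarrow> nat list \<Rightarrow> (nat \<times> nat) set set" where
  "separated_sets_containing x s k ns =
     {A. A \<subseteq> circles ns \<and> card A = k \<and> separated s ns A \<and> x \<in> A}"

end

theory Submission
  imports Defs
begin

text \<open>Splitting a set according to the circles reduces the count to a convolution of the numbers
  of separated subsets of a single circle. Such a subset has at most one element among the first
  \<open>s\<close> points; cutting the circle at this element, or after the first \<open>s\<close> points if
  there is none, leaves a separated subset of a line. The resulting convolution is an instance of
  the Rothe-Hagen identity with negative step. Both sides of that identity satisfy the same
  difference equation in the parameter \<open>x\<close> and agree at \<open>x = 0\<close>.\<close>

section \<open>The Rothe-Hagen identity\<close>

text \<open>The polynomial \<open>x / (x + l z) * ((x + l z) gchoose l)\<close>, written so that the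
  case \<open>x + l z = 0\<close> causes no trouble.\<close>

fun rothe :: "'a::field_char_0 \<Rightarrow> 'a \<Rightarrow> nat \<Rightarrow> 'a" where
  "rothe z x 0 = 1"
| "rothe z x (Suc l) = x / of_nat (Suc l) * ((x + of_nat (Suc l) * z - 1) gchoose l)"

text \<open>Put w = x + (l + 1) z. Pascal's rule and absorption turn both values on the left into
  multiples of \<open>(w - 1) gchoose (l - 1)\<close>, whose coefficients combine to a multiple of x
  + z.\<close>

lemma rothe_diff:
  fixes x z :: "'a::field_char_0"
  shows "rothe z (x + 1) (Suc l) - rothe z x (Suc l) = rothe z (x + z) l"
proof (cases l)
  case 0
  then show ?thesis by simp
next
  case (Suc m)
  define w where "w = x + of_nat (Suc l) * z"
  define g where "g = (w - 1) gchoose m"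
  have a: "of_nat l * ((w - 1) gchoose l) = (w - of_nat l) * g"
    using gbinomial_mult_1[of "w - 1" m]
    unfolding g_def Suc by (simp add: algebra_simps)
  have p: "w gchoose l = g + ((w - 1) gchoose l)"
    unfolding g_def Suc by (subst gbinomial_addition_formula) (rule add.commute)
  have nz: "of_nat (Suc l) \<noteq> (0::'a)" "of_nat l \<noteq> (0::'a)"
    using Suc by (simp_all del: of_nat_Suc)
  have "of_nat l * ((x + 1) * (w gchoose l) - x * ((w - 1) gchoose l))
      = of_nat l * ((x + 1) * g) + of_nat l * ((w - 1) gchoose l)"
    unfolding p by (simp add: algebra_simps)
  also have "\<dots> = of_nat (Suc l) * ((x + z) * g)"
    unfolding a by (simp add: w_def algebra_simps)
  finally have "(x + 1) / of_nat (Suc l) * (w gchoose l) - x / of_nat (Suc l) * ((w - 1) gchoose l)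
      = (x + z) / of_nat l * g"
    using nz by (simp add: divide_simps del: of_nat_Suc) (simp add: mult.commute)
  moreover have "x + 1 + of_nat (Suc l) * z - 1 = w" "x + of_nat (Suc l) * z - 1 = w - 1"
    by (simp_all add: w_def)
  moreover have "rothe z (x + z) l = (x + z) / of_nat l * g"
    by (simp add: Suc g_def w_def algebra_simps)
  ultimately show ?thesis
    by (simp only: rothe.simps)
qed

text \<open>Differencing in \<open>x\<close> lowers \<open>n\<close> by one and replaces
  \<open>x\<close> by \<open>x + z\<close>. As \<open>z\<close> will be negative, \<open>x\<close>
  ranges over the integers rather than the naturals, and the last induction runs in both directions
  from 0.\<close>

lemma rothe_hagen:
  fixes y :: "'a::field_char_0" and x z :: int
  shows "(\<Sum>l\<le>n. rothe (of_int z) (of_int x) l * ((y + of_nat (n - l) * of_int z) gchoose (n - l)))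
    = (of_int x + y + of_nat n * of_int z) gchoose n"
proof (induction n arbitrary: x)
  case 0
  show ?case by simp
next
  case (Suc n)
  let ?b = "\<lambda>l. (y + of_nat (Suc n - l) * of_int z) gchoose (Suc n - l)"
  let ?S = "\<lambda>x. \<Sum>l\<le>Suc n. rothe (of_int z) (of_int x) l * ?b l"
  let ?D = "\<lambda>x. ?S x - ((of_int x + y + of_nat (Suc n) * of_int z) gchoose Suc n)"
  have step: "?D (x + 1) = ?D x" for x
  proof -
    have "?S (x + 1) - ?S x
        = (\<Sum>l\<le>Suc n. (rothe (of_int z) (of_int x + 1) l - rothe (of_int z) (of_int x) l) * ?b l)"
      unfolding of_int_add of_int_1 left_diff_distrib sum_subtractf ..
    also have "\<dots> = (\<Sum>l\<le>n. rothe (of_int z) (of_int (x + z)) l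
        * ((y + of_nat (n - l) * of_int z) gchoose (n - l)))"
      \<comment> \<open>The term l = 0 drops out because \<open>rothe\<close> is constantly 1
        there.\<close>
      unfolding sum.atMost_Suc_shift rothe_diff by simp
    also have "\<dots> = (of_int (x + z) + y + of_nat n * of_int z) gchoose n"
      by (rule Suc.IH)
    also have "\<dots> = ((of_int (x + 1) + y + of_nat (Suc n) * of_int z) gchoose Suc n)
        - ((of_int x + y + of_nat (Suc n) * of_int z) gchoose Suc n)"
      using gbinomial_Suc_Suc[of "of_int x + y + of_nat (Suc n) * of_int z" n]
      by (simp add: algebra_simps)
    finally show ?thesis by (simp only: algebra_simps)
  qed
  have "?D x = 0"
  proof (induction x rule: int_induct[of _ 0])
    case base
    \<comment> \<open>At x = 0 every term with l > 0 carries the factor x.\<close>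
    show ?case unfolding sum.atMost_Suc_shift by simp
  next
    case (step1 i)
    then show ?case using step[of i] by (simp only:)
  next
    case (step2 i)
    then show ?case using step[of "i - 1"] by (simp only: diff_add_cancel)
  qed
  then show ?case by (simp only: right_minus_eq)
qed

section \<open>Separated subsets of a line\<close>

definition line_sets :: "nat \<Rightarrow> nat \<Rightarrow> nat \<Rightarrow> nat \<Rightarrow> nat set set" where
  "line_sets s l M N =
    {A. A \<subseteq> {M..<N} \<and> card A = l \<and> (\<forall>a\<in>A. \<forall>b\<in>A. a < b \<longrightarrow> a + s < b)}"

lemma finite_line_sets [simp]: "finite (line_sets s l M N)"
  by (rule finite_subset[of _ "Pow {M..<N}"]) (auto simp: line_sets_def)

lemma line_sets_0: "line_sets s 0 M N = {{}}"
  by (auto simp: line_sets_def dest: finite_subset)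

lemma card_insert_image:
  assumes "\<And>A. A \<in> F \<Longrightarrow> x \<notin> A"
  shows "card (insert x ` F) = card F"
  using assms by (intro card_image inj_onI) (metis insert_ident)

text \<open>Split on whether \<open>M\<close> is chosen: if it is, the next \<open>s\<close> points
  are blocked and the rest starts at \<open>Suc (M + s)\<close>.\<close>

lemma line_sets_Suc:
  assumes "M < N"
  shows "line_sets s (Suc l) M N =
    line_sets s (Suc l) (Suc M) N \<union> insert M ` line_sets s l (Suc (M + s)) N" (is "?L = ?R")
proof
  show "?L \<subseteq> ?R"
  proof
    fix A assume A: "A \<in> ?L"
    then have fin: "finite A" by (auto simp: line_sets_def intro: finite_subset)
    show "A \<in> ?R"
    proof (cases "M \<in> A")
      case True
      have "A - {M} \<subseteq> {Suc (M + s)..<N}"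
      proof
        fix b assume b: "b \<in> A - {M}"
        then have "M < b" "b < N" using A by (auto simp: line_sets_def order_less_le)
        then show "b \<in> {Suc (M + s)..<N}" using A b True by (auto simp: line_sets_def Suc_le_eq)
      qed
      then have "A - {M} \<in> line_sets s l (Suc (M + s)) N"
        using A True fin by (auto simp: line_sets_def)
      then show ?thesis using True by (intro UnI2 image_eqI[of _ _ "A - {M}"]) auto
    next
      case False
      have "A \<subseteq> {Suc M..<N}"
      proof
        fix b assume "b \<in> A"
        then show "b \<in> {Suc M..<N}"
          using A False by (cases "b = M") (auto simp: line_sets_def Suc_le_eq order_less_le)
      qed
      then show ?thesis using A by (auto simp: line_sets_def)
    qed
  qed
  show "?R \<subseteq> ?L"
  proof
    fix A assume "A \<in> ?R"
    then show "A \<in> ?L"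
    proof
      assume "A \<in> line_sets s (Suc l) (Suc M) N"
      then show ?thesis by (auto simp: line_sets_def dest: Suc_leD)
    next
      assume "A \<in> insert M ` line_sets s l (Suc (M + s)) N"
      then obtain B where B: "A = insert M B" "B \<in> line_sets s l (Suc (M + s)) N" by auto
      then have sub: "B \<subseteq> {Suc (M + s)..<N}" by (simp add: line_sets_def)
      then have "finite B" "M \<notin> B" by (auto intro: finite_subset)
      then have "card A = Suc l" using B by (simp add: line_sets_def)
      moreover have "A \<subseteq> {M..<N}" using sub assms B by fastforce
      moreover have "a + s < b" if "a \<in> A" "b \<in> A" "a < b" for a b
      proof -
        have "a = M \<or> a \<in> B" "b \<in> B" using that sub B by fastforce+
        then show ?thesis using that sub B by (auto simp: line_sets_def Suc_le_eq)
      qed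
      ultimately show ?thesis by (auto simp: line_sets_def)
    qed
  qed
qed

text \<open>The truncated subtractions give the correct value in all cases, including \<open>l = 0\<close>
  and intervals that are too short.\<close>

lemma card_line_sets: "card (line_sets s l M N) = (N - M - (l - 1) * s) choose l"
proof (induction "N - M" arbitrary: M l rule: less_induct)
  case less
  show ?case
  proof (cases l)
    case 0
    then show ?thesis by (simp add: line_sets_0)
  next
    case (Suc m)
    show ?thesis
    proof (cases "M < N")
      case False
      then have "line_sets s l M N = {}" using Suc by (auto simp: line_sets_def)
      then show ?thesis using False Suc by simp
    next
      case True
      have disj: "line_sets s (Suc m) (Suc M) N \<inter> insert M ` line_sets s m (Suc (M + s)) N = {}"
        by (auto simp: line_sets_def)
      have ins: "card (insert M ` line_sets s m (Suc (M + s)) N) = card (line_sets s m (Suc (M + s)) N)"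
        by (rule card_insert_image) (auto simp: line_sets_def)
      have "card (line_sets s l M N) =
          card (line_sets s (Suc m) (Suc M) N) + card (line_sets s m (Suc (M + s)) N)"
        unfolding Suc line_sets_Suc[OF True] by (subst card_Un_disjoint) (use disj ins in auto)
      also have "\<dots> = (N - Suc M - m * s choose Suc m) + (N - Suc (M + s) - (m - 1) * s choose m)"
        using less[of "Suc M" "Suc m"] less[of "Suc (M + s)" m] True by simp
      also have "\<dots> = (N - M - m * s) choose Suc m"
      \<comment> \<open>For m > 0 the two upper entries coincide and Pascal's rule applies. For m =
        0 the truncated \<open>(m - 1) * s\<close> breaks this, but then the second binomial is
        1.\<close>
      proof (cases m)
        case 0
        then show ?thesis using True by simp
      next
        case (Suc r)
        have e: "N - Suc (M + s) - (m - 1) * s = N - Suc M - m * s"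
          using Suc by simp
        show ?thesis
        proof (cases "m * s < N - M")
          case True
          then have "N - M - m * s = Suc (N - Suc M - m * s)" by simp
          then show ?thesis unfolding e by simp
        next
          case False
          then show ?thesis unfolding e using Suc by simp
        qed
      qed
      finally show ?thesis using Suc by simp
    qed
  qed
qed

section \<open>Separated subsets of a circle\<close>

text \<open>The second inequality is the gap through the wrap-around, n - (b - a) - 1 \<ge> s,
  written without subtraction.\<close>

definition circle_sets :: "nat \<Rightarrow> nat \<Rightarrow> nat \<Rightarrow> nat set set" where
  "circle_sets s l n =
    {A. A \<subseteq> {1..n} \<and> card A = l \<and> (\<forall>a\<in>A. \<forall>b\<in>A. a < b \<longrightarrow> a + s < b \<and> b + s < n + a)}"

lemma finite_circle_sets [simp]: "finite (circle_sets s l n)"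
  by (rule finite_subset[of _ "Pow {1..n}"]) (auto simp: circle_sets_def)

lemma circle_sets_0: "circle_sets s 0 n = {{}}"
  by (auto simp: circle_sets_def dest: finite_subset)

text \<open>No element precedes \<open>i\<close>, since i \<le> s leaves fewer than \<open>s\<close>
  points between. Hence the others lie beyond i + s and, by the wrap-around gap to \<open>i\<close>,
  before n + i - s.\<close>

lemma circle_sets_containing:
  assumes "1 \<le> i" "i \<le> s" "s \<le> n"
  shows "{A \<in> circle_sets s (Suc l) n. i \<in> A} = insert i ` line_sets s l (Suc (i + s)) (n + i - s)"
    (is "?L = ?R")
proof
  show "?L \<subseteq> ?R"
  proof
    fix A assume A: "A \<in> ?L"
    then have fin: "finite A" by (auto simp: circle_sets_def intro: finite_subset)
    have "A - {i} \<subseteq> {Suc (i + s)..<n + i - s}"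
    proof
      fix b assume b: "b \<in> A - {i}"
      have "\<not> b < i" using A b assms by (fastforce simp: circle_sets_def)
      then have "i < b" using b by auto
      then have "i + s < b \<and> b + s < n + i" using A b by (auto simp: circle_sets_def)
      then show "b \<in> {Suc (i + s)..<n + i - s}" by auto
    qed
    then have "A - {i} \<in> line_sets s l (Suc (i + s)) (n + i - s)"
      using A fin by (auto simp: circle_sets_def line_sets_def)
    then show "A \<in> ?R" using A by (intro image_eqI[of _ _ "A - {i}"]) auto
  qed
  show "?R \<subseteq> ?L"
  proof
    fix A assume "A \<in> ?R"
    then obtain B where B: "A = insert i B" "B \<in> line_sets s l (Suc (i + s)) (n + i - s)" by auto
    then have sub: "B \<subseteq> {Suc (i + s)..<n + i - s}" by (simp add: line_sets_def)
    then have "finite B" "i \<notin> B" by (auto intro: finite_subset)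
    then have "card A = Suc l" using B by (simp add: line_sets_def)
    moreover have "A \<subseteq> {1..n}" using sub assms B by fastforce
    moreover have "a + s < b \<and> b + s < n + a" if "a \<in> A" "b \<in> A" "a < b" for a b
    proof -
      have "a = i \<or> a \<in> B" "b \<in> B"
        using that sub B by fastforce+
      then have "a + s < b" "i \<le> a" using that sub B by (auto simp: line_sets_def Suc_le_eq)
      \<comment> \<open>As i \<le> a, the wrap-around gap from \<open>b\<close> to \<open>a\<close>
        is at least the one from \<open>b\<close> to \<open>i\<close>.\<close>
      moreover have "b < n + i - s" using sub \<open>b \<in> B\<close> by auto
      ultimately show ?thesis by linarith
    qed
    ultimately show "A \<in> ?L" using B by (auto simp: circle_sets_def)
  qed
qed

lemma card_circle_sets_containing:
  assumes "1 \<le> i" "i \<le> s" "s * Suc l < n"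
  shows "card {A \<in> circle_sets s (Suc l) n. i \<in> A} = (n - s * Suc l - 1) choose l"
proof -
  have "s \<le> n" using assms by simp
  then have "card {A \<in> circle_sets s (Suc l) n. i \<in> A}
      = card (line_sets s l (Suc (i + s)) (n + i - s))"
    unfolding circle_sets_containing[OF assms(1,2) \<open>s \<le> n\<close>]
    by (intro card_insert_image) (auto simp: line_sets_def)
  \<comment> \<open>The interval length n - 2 s - 1 does not depend on \<open>i\<close>; l = 0 is
    separate because \<open>l - 1\<close> is truncated there.\<close>
  also have "\<dots> = (n - s * Suc l - 1) choose l"
    unfolding card_line_sets using assms \<open>s \<le> n\<close> by (cases l) (simp_all add: algebra_simps)
  finally show ?thesis .
qed

text \<open>The \<open>s\<close> empty points already lie in the gap from the last element round to
  the first, so the cyclic condition is automatic.\<close>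

lemma circle_sets_avoiding:
  "{A \<in> circle_sets s l n. A \<inter> {1..s} = {}} = line_sets s l (Suc s) (Suc n)" (is "?L = ?R")
proof (intro set_eqI iffI)
  fix A assume A: "A \<in> ?L"
  then have "A \<subseteq> {Suc s..<Suc n}"
    by (fastforce simp: circle_sets_def not_less_eq_eq)
  then show "A \<in> ?R" using A by (simp add: circle_sets_def line_sets_def)
next
  fix A assume A: "A \<in> ?R"
  then have sub: "A \<subseteq> {Suc s..<Suc n}" by (simp add: line_sets_def)
  have "b + s < n + a" if "a \<in> A" "b \<in> A" for a b
  proof -
    have "Suc s \<le> a" "b < Suc n" using that sub by auto
    then show ?thesis by linarith
  qed
  moreover have "A \<subseteq> {1..n}" "A \<inter> {1..s} = {}" using sub by fastforce+
  ultimately show "A \<in> ?L" using A by (simp add: circle_sets_def line_sets_def)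
qed

lemma card_circle_sets:
  assumes "s * Suc l < n"
  shows "card (circle_sets s (Suc l) n) =
    ((n - s * Suc l) choose Suc l) + s * ((n - s * Suc l - 1) choose l)"
proof -
  let ?C = "circle_sets s (Suc l) n"
  let ?N = "{A \<in> ?C. A \<inter> {1..s} = {}}"
  let ?F = "\<lambda>i. {A \<in> ?C. i \<in> A}"
  have "?C = ?N \<union> (\<Union>i\<in>{1..s}. ?F i)" by auto
  then have "card ?C = card (?N \<union> (\<Union>i\<in>{1..s}. ?F i))" by simp
  also have "\<dots> = card ?N + card (\<Union>i\<in>{1..s}. ?F i)"
    by (rule card_Un_disjoint) auto
  also have "card (\<Union>i\<in>{1..s}. ?F i) = (\<Sum>i\<in>{1..s}. card (?F i))"
  proof (rule card_UN_disjoint)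
    \<comment> \<open>Two points of \<open>{1..s}\<close> have fewer than \<open>s\<close> points
      between them.\<close>
    have "\<not> (A \<in> ?C \<and> i \<in> A \<and> j \<in> A)" if "i < j" "j \<le> s" for A i j
      using that by (fastforce simp: circle_sets_def)
    then show "\<forall>i\<in>{1..s}. \<forall>j\<in>{1..s}. i \<noteq> j \<longrightarrow> ?F i \<inter> ?F j = {}"
      by (fastforce simp: neq_iff)
  qed auto
  also have "\<dots> = s * ((n - s * Suc l - 1) choose l)"
    using assms by (simp add: card_circle_sets_containing)
  also have "card ?N = (n - s * Suc l) choose Suc l"
    unfolding circle_sets_avoiding card_line_sets by (simp add: mult.commute)
  finally show ?thesis .
qed

text \<open>For l > 0 put p = n - s l - 1. Absorption turns C(p + 1, l) into (p + 1) / l * C(p, l -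
  1), and p + 1 + s l = n collects the two summands of the count into n / l * C(p, l - 1).\<close>

lemma card_circle_sets_rothe:
  assumes "s * l < n"
  shows "of_nat (card (circle_sets s l n)) = rothe (- of_nat s) (of_nat n :: 'a::field_char_0) l"
proof (cases l)
  case 0
  then show ?thesis by (simp add: circle_sets_0)
next
  case (Suc m)
  define p where "p = n - s * l - 1"
  have n: "n = Suc p + s * l" using assms by (simp add: p_def)
  have "Suc m * (Suc p choose Suc m) = Suc p * (p choose m)"
    using Suc_times_binomial_eq[of p m] by (simp only: mult.commute)
  then have "Suc m * card (circle_sets s l n) = n * (p choose m)"
    using card_circle_sets[of s m n] assms n unfolding Suc
    by (simp add: algebra_simps del: binomial_Suc_Suc)
  then have "of_nat (Suc m) * of_nat (card (circle_sets s l n)) = (of_nat n * of_nat (p choose m) :: 'a)"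
    by (metis of_nat_mult)
  moreover have "of_nat n + of_nat (Suc m) * (- of_nat s) - 1 = (of_nat p :: 'a)"
    unfolding n Suc by (simp add: algebra_simps)
  ultimately show ?thesis
    unfolding Suc rothe.simps
    by (simp add: binomial_gbinomial field_simps del: of_nat_Suc)
qed

section \<open>Two circles\<close>

text \<open>Here \<open>l\<close> counts the points on the second circle; it is less than
  \<open>k\<close> because the first circle holds the point 1.\<close>

lemma separated_two_circles_iff:
  "B \<times> {1} \<union> C \<times> {2} \<in> separated_sets_containing (1, 1) s k [n, m] \<longleftrightarrow>
    (\<exists>l<k. B \<in> circle_sets s (k - l) n \<and> 1 \<in> B \<and> C \<in> circle_sets s l m)" (is "?L \<longleftrightarrow> ?R")
proof -
  let ?A = "B \<times> {1} \<union> C \<times> {2::nat}"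
  let ?sep = "\<lambda>n B. \<forall>a\<in>B. \<forall>b\<in>B. a < b \<longrightarrow> a + s < b \<and> b + s < n + a"
  have sub: "?A \<subseteq> circles [n, m] \<longleftrightarrow> B \<subseteq> {1..n} \<and> C \<subseteq> {1..m}"
  proof -
    have "{1..length [n, m]} = {1, 2}" by auto
    then have "circles [n, m] = {1..n} \<times> {1} \<union> {1..m} \<times> {2}" by (simp add: circles_def)
    then show ?thesis by auto
  qed
  \<comment> \<open>The condition is symmetric in \<open>a\<close> and \<open>b\<close>, so ordering
    the pair removes the absolute values.\<close>
  have circ: "(\<forall>a\<in>B. \<forall>b\<in>B. a \<noteq> b \<longrightarrow> \<bar>int a - int b\<bar> - 1 \<ge> int s \<and>
        int n - \<bar>int a - int b\<bar> - 1 \<ge> int s) \<longleftrightarrow> ?sep n B" (is "?P \<longleftrightarrow> ?Q") for n and B :: "nat set"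
  proof
    assume P: ?P
    show ?Q
    proof (intro ballI impI)
      fix a b assume "a \<in> B" "b \<in> B" "a < b"
      then show "a + s < b \<and> b + s < n + a" using bspec[OF bspec[OF P], of a b] by auto
    qed
  next
    assume Q: ?Q
    show ?P
    proof (intro ballI impI)
      fix a b assume "a \<in> B" "b \<in> B" "a \<noteq> b"
      then show "\<bar>int a - int b\<bar> - 1 \<ge> int s \<and> int n - \<bar>int a - int b\<bar> - 1 \<ge> int s"
        using bspec[OF bspec[OF Q], of a b] bspec[OF bspec[OF Q], of b a]
        by (cases "a < b") auto
    qed
  qed
  have sep: "separated s [n, m] ?A \<longleftrightarrow> ?sep n B \<and> ?sep m C"
  proof -
    have "(\<forall>a b i. (a, i) \<in> ?A \<and> (b, i) \<in> ?A \<and> a \<noteq> b \<longrightarrow> P i a b) \<longleftrightarrow>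
        (\<forall>a\<in>B. \<forall>b\<in>B. a \<noteq> b \<longrightarrow> P 1 a b) \<and> (\<forall>a\<in>C. \<forall>b\<in>C. a \<noteq> b \<longrightarrow> P 2 a b)" for P
      by auto
    then show ?thesis unfolding circ[symmetric] separated_def by simp
  qed
  have card: "card ?A = card B + card C" if "finite B" "finite C"
    using that by (subst card_Un_disjoint) (auto simp: card_cartesian_product)
  show ?thesis
  proof
    assume L: ?L
    then have fin: "finite B" "finite C"
      using sub by (auto simp: separated_sets_containing_def intro: finite_subset)
    then have "card B + card C = k" "1 \<in> B"
      using L card by (auto simp: separated_sets_containing_def)
    moreover from this fin have "card B > 0" by (auto simp: card_gt_0_iff)
    ultimately show ?R using L sub sep
      by (intro exI[of _ "card C"]) (auto simp: separated_sets_containing_def circle_sets_def)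
  next
    assume R: ?R
    then have "finite B" "finite C"
      by (auto simp: circle_sets_def intro: finite_subset)
    then show ?L using R card sub sep
      by (auto simp: separated_sets_containing_def circle_sets_def)
  qed
qed

lemma card_separated_two_circles:
  "card (separated_sets_containing (1, 1) s k [n, m]) =
    (\<Sum>l<k. card {B \<in> circle_sets s (k - l) n. 1 \<in> B} * card (circle_sets s l m))"
proof -
  let ?X = "\<lambda>l. {B \<in> circle_sets s (k - l) n. 1 \<in> B}"
  let ?f = "\<lambda>(l::nat, B, C). B \<times> {1::nat} \<union> C \<times> {2::nat}"
  let ?D = "SIGMA l:{..<k}. ?X l \<times> circle_sets s l m"
  \<comment> \<open>The inverse slices a set by its second coordinate and recovers \<open>l\<close>
    as the size of the second slice.\<close>
  have "card (?f ` ?D) = card ?D"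
    by (rule card_image, rule inj_on_inverseI[of _ "\<lambda>A. (card {a. (a, 2) \<in> A}, {a. (a, 1) \<in> A}, {a. (a, 2) \<in> A})"])
      (auto simp: circle_sets_def)
  moreover have "?f ` ?D = separated_sets_containing (1, 1) s k [n, m]"
  proof
    show "?f ` ?D \<subseteq> separated_sets_containing (1, 1) s k [n, m]"
      using separated_two_circles_iff[of _ _ s k n m] by auto
    show "separated_sets_containing (1, 1) s k [n, m] \<subseteq> ?f ` ?D"
    proof
      fix A assume A: "A \<in> separated_sets_containing (1, 1) s k [n, m]"
      define B C where "B = {a. (a, 1) \<in> A}" and "C = {a. (a, 2) \<in> A}"
      have "i = 1 \<or> i = 2" if "(a, i) \<in> A" for a i
        using A that by (fastforce simp: separated_sets_containing_def circles_def)
      then have AB: "A = B \<times> {1} \<union> C \<times> {2}"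
        unfolding B_def C_def by fastforce
      then obtain l where "l < k" "B \<in> ?X l" "C \<in> circle_sets s l m"
        using A separated_two_circles_iff by auto
      then show "A \<in> ?f ` ?D" unfolding AB by (intro image_eqI[of _ _ "(l, B, C)"]) auto
    qed
  qed
  ultimately have "card (separated_sets_containing (1, 1) s k [n, m]) = card ?D"
    by (simp only:)
  also have "\<dots> = (\<Sum>l<k. card (?X l) * card (circle_sets s l m))"
    by (subst card_SigmaI) (auto simp: card_cartesian_product)
  finally show ?thesis .
qed

theorem theorem2:
  fixes s k n\<^sub>1 n\<^sub>2 :: nat
  assumes "s \<ge> 1" and "k \<ge> 1"
    and "n\<^sub>1 > 0" and "n\<^sub>2 > 0"
    and "n\<^sub>1 \<ge> s * k + 1" and "n\<^sub>2 \<ge> s * k"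
  shows "card (separated_sets_containing (1, 1) s k [n\<^sub>1, n\<^sub>2]) =
           (n\<^sub>1 + n\<^sub>2 - s * k - 1) choose (k - 1)"
proof -
  obtain r where k: "k = Suc r" using assms by (cases k) auto
  \<comment> \<open>This is the Rothe-Hagen summand for x = \<open>n\<^sub>2\<close>, y =
    \<open>n\<^sub>1 - s - 1\<close>, z = \<open>- s\<close>: the second circle supplies the
    \<open>rothe\<close> factor, the first one, with its point 1 fixed, the binomial.\<close>
  have summand: "of_nat (card {B \<in> circle_sets s (k - l) n\<^sub>1. 1 \<in> B} * card (circle_sets s l n\<^sub>2))
      = rothe (of_int (- int s)) (of_int (int n\<^sub>2)) l
        * ((real n\<^sub>1 - real s - 1 + of_nat (r - l) * of_int (- int s)) gchoose (r - l))"
    if l: "l \<le> r" for l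
  proof -
    have kl: "k - l = Suc (r - l)" using k l by simp
    \<comment> \<open>The second circle holds fewer than \<open>k\<close> points and s \<ge> 1, so
      \<open>n\<^sub>2 \<ge> s * k\<close> is enough there; the first may hold all \<open>k\<close>,
      whence the extra 1 in its bound.\<close>
    have "s * l < s * k" using assms l k by (intro mult_less_mono2) auto
    then have "s * l < n\<^sub>2" using assms by linarith
    have "s * Suc (r - l) \<le> s * k" using k by (intro mult_le_mono) auto
    then have lt: "s * Suc (r - l) < n\<^sub>1" using assms by linarith
    have "real (n\<^sub>1 - s * Suc (r - l) - 1) = real n\<^sub>1 - real (s * Suc (r - l)) - 1"
      using lt by (simp add: of_nat_diff del: mult_Suc_right of_nat_mult)
    also have "\<dots> = real n\<^sub>1 - real s - 1 + of_nat (r - l) * of_int (- int s)"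
      by (simp add: distrib_left mult.commute)
    finally have p: "real (n\<^sub>1 - s * Suc (r - l) - 1) = \<dots>" .
    have X: "card {B \<in> circle_sets s (k - l) n\<^sub>1. 1 \<in> B} = (n\<^sub>1 - s * Suc (r - l) - 1) choose (r - l)"
      unfolding kl using assms(1) lt by (intro card_circle_sets_containing) auto
    show ?thesis
      unfolding of_nat_mult X binomial_gbinomial p
      using card_circle_sets_rothe[OF \<open>s * l < n\<^sub>2\<close>, where 'a = real] by simp
  qed
  have "real (card (separated_sets_containing (1, 1) s k [n\<^sub>1, n\<^sub>2]))
      = (\<Sum>l\<le>r. rothe (of_int (- int s)) (of_int (int n\<^sub>2)) l
        * ((real n\<^sub>1 - real s - 1 + of_nat (r - l) * of_int (- int s)) gchoose (r - l)))"
    unfolding card_separated_two_circles of_nat_sum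
    using summand by (intro sum.cong) (auto simp: k)
  also have "\<dots> = (of_int (int n\<^sub>2) + (real n\<^sub>1 - real s - 1) + of_nat r * of_int (- int s)) gchoose r"
    by (rule rothe_hagen)
  also have "of_int (int n\<^sub>2) + (real n\<^sub>1 - real s - 1) + of_nat r * of_int (- int s)
      = real (n\<^sub>1 + n\<^sub>2 - s * k - 1)"
    using assms by (simp add: of_nat_diff k algebra_simps)
  finally show ?thesis by (simp add: binomial_gbinomial[symmetric] k)
qed

end
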